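(* Let $-\infty<a<b<\infty$. Equip $\mathcal{P}_{[a,b]}$ with the weak topology and $\mathcal{S}^{\mathrm{adm}}_{[a,b]}$ with the subspace topology inherited from the product topology on $\prod_{n=0}^\infty[0,(b-a)^n/n!]$. Then the primitive sequence map $S$ is a homeomorphism between $\mathcal{P}_{[a,b]}$ and $\mathcal{S}^{\mathrm{adm}}_{[a,b]}$; in particular, for $\mu_k,\mu\in\mathcal{P}_{[a,b]}$, $k\ge 1$, the sequence $\{\mu_k\}_k$ converges weakly to $\mu$ as $k\to\infty$ if and only if $\varepsilon_n(\mu_k)\to\varepsilon_n(\mu)$ as $k\to\infty$ for every $n\ge 0$.
   Context: $\mathcal{P}_{[a,b]}$ denotes the set of Borel probability measures on $[a,b]$, with the weak topology (weak convergence of probability measures). For $\mu\in\mathcal{P}_{[a,b]}$ and $n\ge0$ let $\varepsilon_n(\mu):=\frac1{n!}\int_{[a,b]}(b-x)^n\,\mu(dx)$ (with $0^0=1$). The primitive sequence map is $S:\mathcal{P}_{[a,b]}\to\prod_{n=0}^\infty\left[0,(b-a)^n/n!\right]$, $S(\mu)=\{\varepsilon_n(\mu)\}_{n\ge0}$, and $\mathcal{S}^{\mathrm{adm}}_{[a,b]}:=S(\mathcal{P}_{[a,b]})$ is the set of admissible sequences for $[a,b]$. *)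

theory Defs
  imports "HOL-Probability.Probability"
begin

definition borel_probs_on :: "real \<Rightarrow> real \<Rightarrow> real measure set" where
  "borel_probs_on a b =
     {\<mu>. prob_space \<mu> \<and> sets \<mu> = sets (restrict_space borel {a..b})}"

text \<open>Test functions range over all continuous functions on the compact interval \<open>{a..b}\<close>;
  these are automatically bounded. Their values outside \<open>{a..b}\<close>, the space of the
  measures, are irrelevant.\<close>

definition weak_topology_on :: "real \<Rightarrow> real \<Rightarrow> real measure topology" where
  "weak_topology_on a b = topology_generated_by
     {{\<mu> \<in> borel_probs_on a b. (\<integral>x. f x \<partial>\<mu>) \<in> U} | f U.
        continuous_on {a..b} (f :: real \<Rightarrow> real) \<and> open U}"

definition weakly_converges_on ::
    "real \<Rightarrow> real \<Rightarrow> (nat \<Rightarrow> real measure) \<Rightarrow> real measure \<Rightarrow> bool" where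
  "weakly_converges_on a b \<mu>s \<mu> \<longleftrightarrow>
     (\<forall>f :: real \<Rightarrow> real. continuous_on {a..b} f \<longrightarrow>
        (\<lambda>k. \<integral>x. f x \<partial>\<mu>s k) \<longlonglongrightarrow> (\<integral>x. f x \<partial>\<mu>))"

definition primitive_seq :: "real \<Rightarrow> real measure \<Rightarrow> nat \<Rightarrow> real" where
  "primitive_seq b \<mu> n = (1 / fact n) * (\<integral>x. (b - x) ^ n \<partial>\<mu>)"

definition admissible_seqs :: "real \<Rightarrow> real \<Rightarrow> (nat \<Rightarrow> real) set" where
  "admissible_seqs a b = primitive_seq b ` borel_probs_on a b"

definition admissible_topology :: "real \<Rightarrow> real \<Rightarrow> (nat \<Rightarrow> real) topology" where
  "admissible_topology a b =
     subtopology (product_topology (\<lambda>n. top_of_set {0..(b - a) ^ n / fact n}) UNIV)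
       (admissible_seqs a b)"

lemma topspace_weak_topology_on: "topspace (weak_topology_on a b) = borel_probs_on a b"
proof -
  have "borel_probs_on a b \<in> {{\<mu> \<in> borel_probs_on a b. (\<integral>x. f x \<partial>\<mu>) \<in> U} | f U.
        continuous_on {a..b} (f :: real \<Rightarrow> real) \<and> open U}"
    by (rule CollectI, rule exI[of _ "\<lambda>_. 0"], rule exI[of _ UNIV]) auto
  then show ?thesis
    unfolding weak_topology_on_def topology_generated_by_topspace by blast
qed

text \<open>Convergence of sequences in the topology just defined is weak convergence of measures.\<close>

lemma limitin_weak_topology_on_iff:
  assumes "\<mu> \<in> borel_probs_on a b" and "\<And>k. k \<ge> 1 \<Longrightarrow> \<mu>s k \<in> borel_probs_on a b"
  shows "limitin (weak_topology_on a b) \<mu>s \<mu> sequentially \<longleftrightarrow> weakly_converges_on a b \<mu>s \<mu>"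
proof
  assume lim: "limitin (weak_topology_on a b) \<mu>s \<mu> sequentially"
  show "weakly_converges_on a b \<mu>s \<mu>"
    unfolding weakly_converges_on_def
  proof (intro allI impI topological_tendstoI)
    fix f :: "real \<Rightarrow> real" and U
    assume f: "continuous_on {a..b} f" and U: "open U" "(\<integral>x. f x \<partial>\<mu>) \<in> U"
    have "openin (weak_topology_on a b) {\<nu> \<in> borel_probs_on a b. (\<integral>x. f x \<partial>\<nu>) \<in> U}"
      unfolding weak_topology_on_def by (rule topology_generated_by_Basis) (use f U in blast)
    moreover have "\<mu> \<in> {\<nu> \<in> borel_probs_on a b. (\<integral>x. f x \<partial>\<nu>) \<in> U}"
      using U assms(1) by simp
    ultimately
    have "\<forall>\<^sub>F k in sequentially. \<mu>s k \<in> {\<nu> \<in> borel_probs_on a b. (\<integral>x. f x \<partial>\<nu>) \<in> U}"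
      using lim[unfolded limitin_def] by meson
    then show "\<forall>\<^sub>F k in sequentially. (\<integral>x. f x \<partial>\<mu>s k) \<in> U"
      by (rule eventually_mono) blast
  qed
next
  assume conv: "weakly_converges_on a b \<mu>s \<mu>"
  have P: "\<forall>\<^sub>F k in sequentially. \<mu>s k \<in> borel_probs_on a b"
    using assms(2) unfolding eventually_sequentially by blast
  have "\<forall>\<^sub>F k in sequentially. \<mu>s k \<in> V"
    if "generate_topology_on {{\<mu> \<in> borel_probs_on a b. (\<integral>x. f x \<partial>\<mu>) \<in> U} | f U.
        continuous_on {a..b} (f :: real \<Rightarrow> real) \<and> open U} V" and "\<mu> \<in> V" for V
    using that
  proof (induction rule: generate_topology_on.induct)
    case Empty
    then show ?case by simp
  next
    case (Int A B)
    then have "\<forall>\<^sub>F k in sequentially. \<mu>s k \<in> A \<and> \<mu>s k \<in> B"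
      by (intro eventually_conj) auto
    then show ?case by simp
  next
    case (UN K)
    then obtain A where "A \<in> K" "\<mu> \<in> A" by blast
    with UN.IH have "\<forall>\<^sub>F k in sequentially. \<mu>s k \<in> A" by blast
    then show ?case by (rule eventually_mono) (use \<open>A \<in> K\<close> in blast)
  next
    case (Basis V)
    then obtain f :: "real \<Rightarrow> real" and U where
      V: "V = {\<mu> \<in> borel_probs_on a b. (\<integral>x. f x \<partial>\<mu>) \<in> U}"
      and f: "continuous_on {a..b} f" and U: "open U" by blast
    have "(\<integral>x. f x \<partial>\<mu>) \<in> U" using V Basis.prems by blast
    with conv f U have "\<forall>\<^sub>F k in sequentially. (\<integral>x. f x \<partial>\<mu>s k) \<in> U"
      unfolding weakly_converges_on_def by (metis topological_tendstoD)
    with P have "\<forall>\<^sub>F k in sequentially. \<mu>s k \<in> borel_probs_on a b \<and> (\<integral>x. f x \<partial>\<mu>s k) \<in> U"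
      by (rule eventually_conj)
    then show ?case using V by simp
  qed
  then show "limitin (weak_topology_on a b) \<mu>s \<mu> sequentially"
    using assms(1) unfolding limitin_def topspace_weak_topology_on
    by (auto simp: weak_topology_on_def openin_topology_generated_by_iff)
qed

end

theory Submission
  imports Defs
begin

text \<open>By the Weierstrass theorem a continuous \<open>f\<close> is uniformly close on \<open>{a..b}\<close> to a
  polynomial in \<open>b - x\<close>, whose integral is a finite linear combination of the \<open>\<epsilon>\<^sub>n\<close>.
  Hence \<open>S(\<mu>) \<mapsto> \<integral> f d\<mu>\<close> is a uniform limit of continuous functions of the sequence. This makes
  \<open>S\<close> injective, because the functions \<open>cos (t x)\<close> and \<open>sin (t x)\<close> determine the characteristic
  function, and it makes \<open>S\<inverse>\<close> continuous, because the integrals generate the weak topology.\<close>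

section \<open>Integrability and bounds on the interval\<close>

lemma borel_probs_on_space:
  assumes "\<mu> \<in> borel_probs_on a b"
  shows "space \<mu> = {a..b}"
proof -
  have "sets \<mu> = sets (restrict_space borel {a..b})"
    using assms by (simp add: borel_probs_on_def)
  then have "space \<mu> = space (restrict_space borel {a..b})"
    by (rule sets_eq_imp_space_eq)
  then show ?thesis
    by (simp add: space_restrict_space)
qed

lemma borel_probs_on_continuous_measurable:
  assumes "\<mu> \<in> borel_probs_on a b" and "continuous_on {a..b} f"
  shows "f \<in> borel_measurable \<mu>"
proof -
  have "sets \<mu> = sets (restrict_space borel {a..b})"
    using assms by (simp add: borel_probs_on_def)
  then show ?thesis
    using borel_measurable_continuous_on_restrict[OF assms(2)]
    by (simp cong: measurable_cong_sets)
qed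

text \<open>Compactness of \<open>{a..b}\<close> bounds \<open>f\<close>, and a bounded measurable
  function is integrable for a finite measure. Banach-valued \<open>f\<close> are allowed because
  the complex exponential is integrated later as well as real functions.\<close>

lemma borel_probs_on_integrable:
  fixes f :: "real \<Rightarrow> 'c::{banach, second_countable_topology}"
  assumes \<mu>: "\<mu> \<in> borel_probs_on a b" and f: "continuous_on {a..b} f"
  shows "integrable \<mu> f"
proof -
  interpret prob_space \<mu> using \<mu> by (simp add: borel_probs_on_def)
  have "bounded (f ` {a..b})"
    using f by (intro compact_imp_bounded compact_continuous_image) auto
  then obtain B where "\<And>x. x \<in> {a..b} \<Longrightarrow> norm (f x) \<le> B"
    unfolding bounded_iff by blast
  then show ?thesis
    using borel_probs_on_space[OF \<mu>] borel_probs_on_continuous_measurable[OF \<mu> f]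
    by (intro integrable_const_bound[of _ B]) auto
qed

text \<open>On the space of \<mu> one has 0 \<le> b - x \<le> b - a, and \<mu> has mass 1. This
  places every admissible sequence in the product of intervals underlying
  \<open>admissible_topology\<close>.\<close>

lemma primitive_seq_bounds:
  assumes \<mu>: "\<mu> \<in> borel_probs_on a b"
  shows "primitive_seq b \<mu> n \<in> {0..(b - a) ^ n / fact n}"
proof -
  interpret prob_space \<mu> using \<mu> by (simp add: borel_probs_on_def)
  have int: "integrable \<mu> (\<lambda>x. (b - x) ^ n)"
    by (rule borel_probs_on_integrable[OF \<mu>]) (intro continuous_intros)
  have "(\<integral>x. (b - x) ^ n \<partial>\<mu>) \<ge> 0"
    using borel_probs_on_space[OF \<mu>] by (intro integral_nonneg_AE) auto
  moreover have "(\<integral>x. (b - x) ^ n \<partial>\<mu>) \<le> (b - a) ^ n"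
    using borel_probs_on_space[OF \<mu>]
    by (intro integral_le_const int) (auto intro!: power_mono)
  ultimately show ?thesis
    by (simp add: primitive_seq_def divide_right_mono)
qed

section \<open>Uniform approximation of integrals by finitely many \<epsilon>_n\<close>

text \<open>A uniform error on the interval survives integration against any probability measure.
  Hence \<open>c\<close> and \<open>n\<close> depend on \<open>f\<close> and \<open>e\<close> only,
  not on \<mu>; this uniformity is what later yields continuity of the inverse.\<close>

lemma integral_approx_by_primitive_seq:
  fixes f :: "real \<Rightarrow> real"
  assumes f: "continuous_on {a..b} f" and e: "0 < e"
  obtains c :: "nat \<Rightarrow> real" and n where
    "\<And>\<mu>. \<mu> \<in> borel_probs_on a b \<Longrightarrow>
       \<bar>(\<Sum>i\<le>n. c i * primitive_seq b \<mu> i) - (\<integral>x. f x \<partial>\<mu>)\<bar> < e"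
proof -
  \<comment> \<open>The substitution y = b - x turns powers of y into the integrands of
    \<epsilon>_n. The tolerance \<open>e / 2\<close> leaves room for a strict bound at the end,
    since integration only preserves the non-strict one.\<close>
  have "continuous_on {0..b - a} (\<lambda>y. f (b - y))"
    by (rule continuous_on_compose2[OF f]) (auto intro!: continuous_intros)
  then obtain g where g: "real_polynomial_function g"
      "\<And>y. y \<in> {0..b - a} \<Longrightarrow> \<bar>f (b - y) - g y\<bar> < e / 2"
    using Stone_Weierstrass_real_polynomial_function[of "{0..b - a}" _ "e / 2"] e
    by (metis compact_Icc half_gt_zero)
  then obtain d n where gd: "g = (\<lambda>y. \<Sum>i\<le>n. d i * y ^ i)"
    unfolding real_polynomial_function_iff_sum by blast
  show thesis
  proof
    fix \<mu> assume \<mu>: "\<mu> \<in> borel_probs_on a b"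
    then interpret prob_space \<mu> by (simp add: borel_probs_on_def)
    note int = borel_probs_on_integrable[OF \<mu>]
    have intg: "integrable \<mu> (\<lambda>x. g (b - x))"
      unfolding gd by (intro int continuous_intros)
    have near: "\<bar>g (b - x) - f x\<bar> \<le> e / 2" if "x \<in> space \<mu>" for x
      using g(2)[of "b - x"] that borel_probs_on_space[OF \<mu>] by (auto simp: abs_minus_commute)
    have "(\<integral>x. g (b - x) \<partial>\<mu>) = (\<Sum>i\<le>n. d i * (\<integral>x. (b - x) ^ i \<partial>\<mu>))"
      unfolding gd
      by (subst Bochner_Integration.integral_sum) (auto intro!: int continuous_intros)
    \<comment> \<open>The factor \<open>fact i\<close> cancels the normalisation of \<epsilon>_i, so
      \<open>d i * fact i\<close> is the coefficient sought.\<close>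
    also have "\<dots> = (\<Sum>i\<le>n. (d i * fact i) * primitive_seq b \<mu> i)"
      by (simp add: primitive_seq_def)
    finally have "(\<Sum>i\<le>n. (d i * fact i) * primitive_seq b \<mu> i) - (\<integral>x. f x \<partial>\<mu>)
        = (\<integral>x. g (b - x) - f x \<partial>\<mu>)"
      using intg int[OF f] by simp
    also have "\<bar>\<dots>\<bar> \<le> (\<integral>x. \<bar>g (b - x) - f x\<bar> \<partial>\<mu>)"
      by (rule integral_abs_bound)
    also have "\<dots> \<le> e / 2"
      using intg int[OF f] near by (intro integral_le_const) auto
    finally show "\<bar>(\<Sum>i\<le>n. (d i * fact i) * primitive_seq b \<mu> i) - (\<integral>x. f x \<partial>\<mu>)\<bar> < e"
      using e by linarith
  qed
qed

section \<open>Injectivity of the primitive sequence map\<close>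

text \<open>Equal sequences give the same approximating sum for both integrals. If the integrals
  differed, an error below half their gap would contradict the triangle inequality.\<close>

lemma primitive_seq_eq_imp_integral_eq:
  fixes f :: "real \<Rightarrow> real"
  assumes \<mu>: "\<mu> \<in> borel_probs_on a b" and \<nu>: "\<nu> \<in> borel_probs_on a b"
    and eq: "primitive_seq b \<mu> = primitive_seq b \<nu>"
    and f: "continuous_on {a..b} f"
  shows "(\<integral>x. f x \<partial>\<mu>) = (\<integral>x. f x \<partial>\<nu>)"
proof (rule ccontr)
  assume "(\<integral>x. f x \<partial>\<mu>) \<noteq> (\<integral>x. f x \<partial>\<nu>)"
  then have "0 < \<bar>(\<integral>x. f x \<partial>\<mu>) - (\<integral>x. f x \<partial>\<nu>)\<bar> / 2" (is "0 < ?e") by simp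
  then obtain c n where "\<And>\<mu>. \<mu> \<in> borel_probs_on a b \<Longrightarrow>
      \<bar>(\<Sum>i\<le>n. c i * primitive_seq b \<mu> i) - (\<integral>x. f x \<partial>\<mu>)\<bar> < ?e"
    using integral_approx_by_primitive_seq[OF f] by blast
  from this[OF \<mu>] this[OF \<nu>] show False
    using dist_triangle_half_r[of "\<Sum>i\<le>n. c i * primitive_seq b \<nu> i" "\<integral>x. f x \<partial>\<mu>"
        "\<bar>(\<integral>x. f x \<partial>\<mu>) - (\<integral>x. f x \<partial>\<nu>)\<bar>" "\<integral>x. f x \<partial>\<nu>"]
    unfolding eq dist_real_def by simp
qed

text \<open>Levy's uniqueness theorem concerns distributions on the whole line, so both measures are
  pushed forward along the inclusion of \<open>{a..b}\<close>. Their characteristic functions agree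
  by testing with cosines and sines.\<close>

lemma borel_probs_on_eqI:
  assumes \<mu>: "\<mu> \<in> borel_probs_on a b" and \<nu>: "\<nu> \<in> borel_probs_on a b"
    and eq: "\<And>f :: real \<Rightarrow> real. continuous_on {a..b} f \<Longrightarrow> (\<integral>x. f x \<partial>\<mu>) = (\<integral>x. f x \<partial>\<nu>)"
  shows "\<mu> = \<nu>"
proof -
  have real_distr: "real_distribution (distr M borel (\<lambda>x. x))"
    and char_distr: "char (distr M borel (\<lambda>x. x)) t
        = Complex (\<integral>x. cos (t * x) \<partial>M) (\<integral>x. sin (t * x) \<partial>M)"
    and emeasure_distr_id: "A \<in> sets M \<Longrightarrow> emeasure (distr M borel (\<lambda>x. x)) A = emeasure M A"
    if M: "M \<in> borel_probs_on a b" for M t A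
  proof -
    interpret prob_space M using M by (simp add: borel_probs_on_def)
    have meas: "(\<lambda>x. x) \<in> borel_measurable M"
      by (rule borel_probs_on_continuous_measurable[OF M]) (intro continuous_intros)
    then show "real_distribution (distr M borel (\<lambda>x. x))" by simp
    have int: "integrable M (\<lambda>x. iexp (t * x))"
      by (rule borel_probs_on_integrable[OF M]) (intro continuous_intros)
    have "char (distr M borel (\<lambda>x. x)) t = (CLINT x|M. iexp (t * x))"
      unfolding char_def using meas by (subst integral_distr) auto
    also have "\<dots> = Complex (\<integral>x. cos (t * x) \<partial>M) (\<integral>x. sin (t * x) \<partial>M)"
      using integral_Re[OF int] integral_Im[OF int]
      by (simp add: complex_eq_iff flip: exp_Euler of_real_mult cis_conv_exp)
    finally show "char (distr M borel (\<lambda>x. x)) t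
        = Complex (\<integral>x. cos (t * x) \<partial>M) (\<integral>x. sin (t * x) \<partial>M)" .
    assume A: "A \<in> sets M"
    moreover have "sets M = sets (restrict_space borel {a..b})"
      using M by (simp add: borel_probs_on_def)
    \<comment> \<open>Since \<open>{a..b}\<close> is Borel, its measurable subsets are Borel in the
      line; the inclusion pulls each back to itself, so the pushforward determines the
      measure.\<close>
    ultimately have "A \<in> sets borel"
      by (simp add: sets_restrict_space_iff)
    then show "emeasure (distr M borel (\<lambda>x. x)) A = emeasure M A"
      using meas sets.sets_into_space[OF A] by (simp add: emeasure_distr Int_absorb2)
  qed
  have "char (distr \<mu> borel (\<lambda>x. x)) = char (distr \<nu> borel (\<lambda>x. x))"
  proof
    fix t
    have "(\<integral>x. cos (t * x) \<partial>\<mu>) = (\<integral>x. cos (t * x) \<partial>\<nu>)" "(\<integral>x. sin (t * x) \<partial>\<mu>) = (\<integral>x. sin (t * x) \<partial>\<nu>)"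
      by (rule eq, intro continuous_intros)+
    then show "char (distr \<mu> borel (\<lambda>x. x)) t = char (distr \<nu> borel (\<lambda>x. x)) t"
      by (simp add: char_distr[OF \<mu>] char_distr[OF \<nu>])
  qed
  then have distr_eq: "distr \<mu> borel (\<lambda>x. x) = distr \<nu> borel (\<lambda>x. x)"
    by (intro Levy_uniqueness real_distr \<mu> \<nu>)
  have sets_eq: "sets \<mu> = sets \<nu>"
    using \<mu> \<nu> by (simp add: borel_probs_on_def)
  show ?thesis
  proof (rule measure_eqI[OF sets_eq])
    fix A assume "A \<in> sets \<mu>"
    then show "emeasure \<mu> A = emeasure \<nu> A"
      using emeasure_distr_id[OF \<mu>] emeasure_distr_id[OF \<nu>] sets_eq distr_eq by metis
  qed
qed

lemma inj_on_primitive_seq: "inj_on (primitive_seq b) (borel_probs_on a b)"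
proof (rule inj_onI)
  fix \<mu> \<nu>
  assume "\<mu> \<in> borel_probs_on a b" "\<nu> \<in> borel_probs_on a b" "primitive_seq b \<mu> = primitive_seq b \<nu>"
  then show "\<mu> = \<nu>"
    by (intro borel_probs_on_eqI primitive_seq_eq_imp_integral_eq) auto
qed

section \<open>Continuity of the map and of its inverse\<close>

lemma topspace_admissible_topology: "topspace (admissible_topology a b) = admissible_seqs a b"
  using primitive_seq_bounds[of _ a b]
  by (fastforce simp: admissible_topology_def admissible_seqs_def topspace_product_topology)

lemma continuous_map_weak_integral:
  assumes "continuous_on {a..b} (f :: real \<Rightarrow> real)"
  shows "continuous_map (weak_topology_on a b) euclidean (\<lambda>\<mu>. \<integral>x. f x \<partial>\<mu>)"
  unfolding continuous_map_def topspace_weak_topology_on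
proof (intro conjI allI impI)
  fix U :: "real set" assume "openin euclidean U"
  then show "openin (weak_topology_on a b) {\<mu> \<in> borel_probs_on a b. (\<integral>x. f x \<partial>\<mu>) \<in> U}"
    unfolding weak_topology_on_def
    by (intro topology_generated_by_Basis) (use assms in auto)
qed simp

text \<open>Continuity into a product is checked coordinatewise, and each \<epsilon>_n is a multiple
  of the integral of a continuous test function.\<close>

lemma continuous_map_primitive_seq:
  "continuous_map (weak_topology_on a b) (admissible_topology a b) (primitive_seq b)"
  unfolding admissible_topology_def continuous_map_in_subtopology continuous_map_componentwise_UNIV
proof (intro conjI allI)
  fix n
  have "continuous_map (weak_topology_on a b) euclidean (\<lambda>\<mu>. \<integral>x. (b - x) ^ n \<partial>\<mu>)"
    by (intro continuous_map_weak_integral continuous_intros)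
  then have "continuous_map (weak_topology_on a b) euclidean (\<lambda>\<mu>. primitive_seq b \<mu> n)"
    unfolding primitive_seq_def by (intro continuous_map_real_mult) auto
  then show "continuous_map (weak_topology_on a b) euclideanreal (\<lambda>\<mu>. primitive_seq b \<mu> n)"
    by simp
next
  fix n
  show "(\<lambda>\<mu>. primitive_seq b \<mu> n) \<in> topspace (weak_topology_on a b) \<rightarrow> {0..(b - a) ^ n / fact n}"
    using primitive_seq_bounds by (auto simp: topspace_weak_topology_on)
next
  show "primitive_seq b \<in> topspace (weak_topology_on a b) \<rightarrow> admissible_seqs a b"
    by (auto simp: topspace_weak_topology_on admissible_seqs_def)
qed

lemma continuous_map_admissible_component:
  "continuous_map (admissible_topology a b) euclidean (\<lambda>s. s n)"
proof -
  have "continuous_map (admissible_topology a b) (top_of_set {0..(b - a) ^ n / fact n}) (\<lambda>s. s n)"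
    unfolding admissible_topology_def
    by (intro continuous_map_from_subtopology continuous_map_product_projection) simp
  then show ?thesis
    by (simp add: continuous_map_in_subtopology)
qed

lemma continuous_map_integral_inv_primitive_seq:
  assumes f: "continuous_on {a..b} (f :: real \<Rightarrow> real)"
  shows "continuous_map (admissible_topology a b) euclidean
    (\<lambda>s. \<integral>x. f x \<partial>(inv_into (borel_probs_on a b) (primitive_seq b) s))"
    (is "continuous_map ?X _ ?g")
proof -
  have "\<exists>F. continuous_map ?X euclidean F \<and> (\<forall>s \<in> topspace ?X. dist (F s) (?g s) < e)"
    if "0 < e" for e
  proof -
    obtain c n where cn: "\<And>\<mu>. \<mu> \<in> borel_probs_on a b \<Longrightarrow>
        \<bar>(\<Sum>i\<le>n. c i * primitive_seq b \<mu> i) - (\<integral>x. f x \<partial>\<mu>)\<bar> < e"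
      using integral_approx_by_primitive_seq[OF f \<open>0 < e\<close>] by blast
    have "continuous_map ?X euclidean (\<lambda>s. \<Sum>i\<le>n. c i * s i)"
      by (intro continuous_map_sum continuous_map_real_mult continuous_map_admissible_component) auto
    \<comment> \<open>An admissible \<open>s\<close> is the primitive sequence of its preimage
      measure, so the approximation applies with \<epsilon>_i replaced by the coordinate
      \<open>s i\<close>.\<close>
    moreover have "dist (\<Sum>i\<le>n. c i * s i) (?g s) < e" if "s \<in> topspace ?X" for s
      using that cn[OF inv_into_into[of s "primitive_seq b"]]
      by (simp add: topspace_admissible_topology admissible_seqs_def dist_real_def f_inv_into_f)
    ultimately show ?thesis by blast
  qed
  then obtain F where F: "\<And>e. 0 < e \<Longrightarrow> continuous_map ?X euclidean (F e)"
      "\<And>e s. 0 < e \<Longrightarrow> s \<in> topspace ?X \<Longrightarrow> dist (F e s) (?g s) < e"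
    by metis
  \<comment> \<open>The approximants are indexed by their own error \<open>e\<close>, and the
    uniform limit is taken along e \<rightarrow> 0 from the right.\<close>
  have pos: "\<forall>\<^sub>F e in at_right (0::real). 0 < e"
    by (simp add: eventually_at_right_less)
  show ?thesis
    unfolding mtopology_is_euclidean[symmetric]
  proof (rule Met_TC.continuous_map_uniform_limit)
    show "\<forall>\<^sub>F e in at_right 0. continuous_map ?X Met_TC.mtopology (F e)"
      unfolding mtopology_is_euclidean using pos by (rule eventually_mono) (rule F(1))
    fix d :: real assume "0 < d"
    then have "\<forall>\<^sub>F e in at_right 0. e \<in> {0<..<d}"
      by (rule eventually_at_right_real)
    then show "\<forall>\<^sub>F e in at_right 0. \<forall>s\<in>topspace ?X. ?g s \<in> UNIV \<and> dist (F e s) (?g s) < d"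
      by (rule eventually_mono) (use F(2) in \<open>force dest: less_trans\<close>)
  qed simp
qed

text \<open>Only preimages of the generating sets of the weak topology need be open, and each such
  set is given by an open condition on a single integral.\<close>

lemma continuous_map_inv_primitive_seq:
  "continuous_map (admissible_topology a b) (weak_topology_on a b)
     (inv_into (borel_probs_on a b) (primitive_seq b))" (is "continuous_map ?X _ ?T")
proof -
  have T: "?T s \<in> borel_probs_on a b" if "s \<in> topspace ?X" for s
    using that by (simp add: topspace_admissible_topology admissible_seqs_def inv_into_into)
  show ?thesis
    unfolding weak_topology_on_def
  proof (rule continuous_on_generated_topo)
    fix V
    assume "V \<in> {{\<mu> \<in> borel_probs_on a b. (\<integral>x. f x \<partial>\<mu>) \<in> U} | f U.
        continuous_on {a..b} (f :: real \<Rightarrow> real) \<and> open U}"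
    then obtain f :: "real \<Rightarrow> real" and U where
      V: "V = {\<mu> \<in> borel_probs_on a b. (\<integral>x. f x \<partial>\<mu>) \<in> U}"
      and f: "continuous_on {a..b} f" and U: "open U" by blast
    have "?T -` V \<inter> topspace ?X = {s \<in> topspace ?X. (\<integral>x. f x \<partial>(?T s)) \<in> U}"
      using T V by auto
    then show "openin ?X (?T -` V \<inter> topspace ?X)"
      using openin_continuous_map_preimage[OF continuous_map_integral_inv_primitive_seq[OF f]] U
      by simp
  next
    show "?T ` topspace ?X \<subseteq> \<Union> {{\<mu> \<in> borel_probs_on a b. (\<integral>x. f x \<partial>\<mu>) \<in> U} | f U.
        continuous_on {a..b} (f :: real \<Rightarrow> real) \<and> open U}"
      unfolding topology_generated_by_topspace[symmetric] weak_topology_on_def[symmetric]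
        topspace_weak_topology_on
      using T by blast
  qed
qed

section \<open>Homeomorphism and the criterion for weak convergence\<close>

lemma homeomorphic_maps_primitive_seq:
  "homeomorphic_maps (weak_topology_on a b) (admissible_topology a b)
     (primitive_seq b) (inv_into (borel_probs_on a b) (primitive_seq b))"
  unfolding homeomorphic_maps_def
  by (simp add: continuous_map_primitive_seq continuous_map_inv_primitive_seq
      topspace_weak_topology_on topspace_admissible_topology inj_on_primitive_seq
      admissible_seqs_def f_inv_into_f)

text \<open>Limits in a product are coordinatewise; the restrictions to the intervals and to the
  admissible set add nothing, as the limit and eventually all terms lie in them.\<close>

lemma limitin_admissible_topology_iff:
  assumes s: "s \<in> admissible_seqs a b" and ss: "\<forall>\<^sub>F k in F. ss k \<in> admissible_seqs a b"
  shows "limitin (admissible_topology a b) ss s F \<longleftrightarrow> (\<forall>n. ((\<lambda>k. ss k n) \<longlongrightarrow> s n) F)"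
proof -
  have box: "t n \<in> {0..(b - a) ^ n / fact n}" if "t \<in> admissible_seqs a b" for t n
    using that primitive_seq_bounds unfolding admissible_seqs_def by blast
  have "\<forall>\<^sub>F k in F. ss k \<in> topspace (product_topology (\<lambda>n. top_of_set {0..(b - a) ^ n / fact n}) UNIV)"
    using ss by (rule eventually_mono) (use box in auto)
  moreover have "\<forall>\<^sub>F k in F. ss k n \<in> {0..(b - a) ^ n / fact n}" for n
    using ss by (rule eventually_mono) (rule box)
  ultimately show ?thesis
    unfolding admissible_topology_def limitin_subtopology limitin_componentwise
    using s ss box[OF s] by simp
qed

theorem theorem3:
  fixes a b :: real
  assumes "a < b"
  shows "homeomorphic_map (weak_topology_on a b) (admissible_topology a b) (primitive_seq b) \<and>
    (\<forall>(\<mu>s :: nat \<Rightarrow> real measure) \<mu>.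
       (\<forall>k\<ge>1. \<mu>s k \<in> borel_probs_on a b) \<and> \<mu> \<in> borel_probs_on a b \<longrightarrow>
       (weakly_converges_on a b \<mu>s \<mu> \<longleftrightarrow>
        (\<forall>n. (\<lambda>k. primitive_seq b (\<mu>s k) n) \<longlonglongrightarrow> primitive_seq b \<mu> n)))"
proof (intro conjI allI impI)
  show "homeomorphic_map (weak_topology_on a b) (admissible_topology a b) (primitive_seq b)"
    using homeomorphic_maps_primitive_seq homeomorphic_map_maps by blast
next
  fix \<mu>s :: "nat \<Rightarrow> real measure" and \<mu>
  assume "(\<forall>k\<ge>1. \<mu>s k \<in> borel_probs_on a b) \<and> \<mu> \<in> borel_probs_on a b"
  then have \<mu>s: "\<And>k. k \<ge> 1 \<Longrightarrow> \<mu>s k \<in> borel_probs_on a b" and \<mu>: "\<mu> \<in> borel_probs_on a b"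
    by blast+
  let ?T = "inv_into (borel_probs_on a b) (primitive_seq b)"
  let ?s = "primitive_seq b \<mu>" and ?ss = "primitive_seq b \<circ> \<mu>s"
  \<comment> \<open>Nothing is known about the term at k = 0, so membership, and below the identity
    \<open>?T (?ss k) = \<mu>s k\<close>, is available only eventually.\<close>
  have ev: "\<forall>\<^sub>F k in sequentially. \<mu>s k \<in> borel_probs_on a b"
    using \<mu>s unfolding eventually_sequentially by blast
  have "limitin (weak_topology_on a b) \<mu>s \<mu> sequentially
      \<longleftrightarrow> limitin (admissible_topology a b) ?ss ?s sequentially"
  proof
    assume "limitin (weak_topology_on a b) \<mu>s \<mu> sequentially"
    then show "limitin (admissible_topology a b) ?ss ?s sequentially"
      by (rule continuous_map_limit[OF continuous_map_primitive_seq])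
  next
    assume "limitin (admissible_topology a b) ?ss ?s sequentially"
    then have "limitin (weak_topology_on a b) (?T \<circ> ?ss) (?T ?s) sequentially"
      by (rule continuous_map_limit[OF continuous_map_inv_primitive_seq])
    moreover have "?T ?s = \<mu>"
      using \<mu> by (simp add: inj_on_primitive_seq)
    moreover have "\<forall>\<^sub>F k in sequentially. (?T \<circ> ?ss) k = \<mu>s k"
      using ev by (rule eventually_mono) (simp add: inj_on_primitive_seq)
    ultimately show "limitin (weak_topology_on a b) \<mu>s \<mu> sequentially"
      using limitin_transform_eventually by metis
  qed
  also have "\<dots> \<longleftrightarrow> (\<forall>n. (\<lambda>k. ?ss k n) \<longlonglongrightarrow> ?s n)"
  proof (rule limitin_admissible_topology_iff)
    show "?s \<in> admissible_seqs a b"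
      using \<mu> by (simp add: admissible_seqs_def)
    show "\<forall>\<^sub>F k in sequentially. ?ss k \<in> admissible_seqs a b"
      using ev by (rule eventually_mono) (simp add: admissible_seqs_def)
  qed
  finally show "weakly_converges_on a b \<mu>s \<mu> \<longleftrightarrow>
      (\<forall>n. (\<lambda>k. primitive_seq b (\<mu>s k) n) \<longlonglongrightarrow> primitive_seq b \<mu> n)"
    using limitin_weak_topology_on_iff[OF \<mu> \<mu>s] by simp
qed

end
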